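(* Let $1\le k<d$, let $A=(A_n)_{n\in\mathbb Z}\in \mathcal L^{\rm Lya}(\mathbb Z,\mathbb R^{k\times k})$, $B=(B_n)_{n\in\mathbb Z}\in\mathcal L^{\rm Lya}(\mathbb Z,\mathbb R^{(d-k)\times(d-k)})$ and $C=(C_n)_{n\in\mathbb Z}\in\mathcal L^{\infty}(\mathbb Z,\mathbb R^{k\times(d-k)})$, and consider the system $x_{n+1}=D_nx_n$, $n\in\mathbb Z$, where \[ D_n=\begin{pmatrix}A_n & C_n\\ 0 & B_n\end{pmatrix}. \] Then \[ \Sigma^{\pm}_{\rm ED}(A)\cup\Sigma^{\pm}_{\rm ED}(B)\subset\Sigma_{\rm ED}(D)\subset\Sigma_{\rm ED}(A)\cup\Sigma_{\rm ED}(B), \] where $\Sigma^{\pm}_{\rm ED}(A):=\Sigma^{+}_{\rm ED}(A)\cup\Sigma^{-}_{\rm ED}(A)$ and $\Sigma^{\pm}_{\rm ED}(B):=\Sigma^{+}_{\rm ED}(B)\cup\Sigma^{-}_{\rm ED}(B)$.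
   Context: For $\mathbb T\in\{\mathbb Z,\mathbb Z_{\ge0},\mathbb Z_{\le0}\}$, $\mathcal L^{\infty}(\mathbb T,\mathbb R^{p\times q})$ is the set of bounded sequences $(M_n)_{n\in\mathbb T}$ of $p\times q$ real matrices; $\mathcal L^{\rm Lya}(\mathbb T,\mathbb R^{p\times p})$ is the set of $M\in\mathcal L^\infty(\mathbb T,\mathbb R^{p\times p})$ with every $M_n$ invertible and $(M_n^{-1})$ bounded. For $M\in\mathcal L^{\rm Lya}(\mathbb Z,\mathbb R^{p\times p})$ the evolution operator of $x_{n+1}=M_nx_n$ is $\Phi_M(m,n)=M_{m-1}\cdots M_n$ for $m>n$, $\Phi_M(n,n)=\mathrm{id}$, $\Phi_M(m,n)=M_m^{-1}\cdots M_{n-1}^{-1}$ for $m<n$. The system has an exponential dichotomy (ED) on $\mathbb T$ if there exist $K,\alpha>0$ and invariant projections $(P_n)_{n\in\mathbb T}$ ($P_m\Phi_M(m,n)=\Phi_M(m,n)P_n$) with $\|\Phi_M(m,n)P_n\|\le Ke^{-\alpha(m-n)}$ for $m\ge n$ and $\|\Phi_M(m,n)(\mathrm{id}-P_n)\|\le Ke^{\alpha(m-n)}$ for $m\le n$, $m,n\in\mathbb T$. Dichotomy spectra: $\Sigma_{\rm ED}(M)$, $\Sigma^+_{\rm ED}(M)$, $\Sigma^-_{\rm ED}(M)$ are the sets of $\gamma\in\mathbb R$ for which $x_{n+1}=e^{-\gamma}M_nx_n$ has no ED on $\mathbb Z$, $\mathbb Z_{\ge0}$, $\mathbb Z_{\le0}$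 respectively. *)

theory Defs
  imports "HOL-Analysis.Analysis"
begin

definition bounded_seq :: "int set \<Rightarrow> (int \<Rightarrow> real^'q^'p) \<Rightarrow> bool" where
  "bounded_seq T M \<longleftrightarrow> bounded (M ` T)"

definition lya_seq :: "int set \<Rightarrow> (int \<Rightarrow> real^'p^'p) \<Rightarrow> bool" where
  "lya_seq T M \<longleftrightarrow> bounded_seq T M \<and> (\<forall>n\<in>T. invertible (M n))
      \<and> bounded_seq T (\<lambda>n. matrix_inv (M n))"

fun evo_fwd :: "(int \<Rightarrow> real^'p^'p) \<Rightarrow> int \<Rightarrow> nat \<Rightarrow> real^'p^'p" where
  "evo_fwd M n 0 = mat 1"
| "evo_fwd M n (Suc k) = M (n + int k) ** evo_fwd M n k"

fun evo_bwd :: "(int \<Rightarrow> real^'p^'p) \<Rightarrow> int \<Rightarrow> nat \<Rightarrow> real^'p^'p" where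
  "evo_bwd M n 0 = mat 1"
| "evo_bwd M n (Suc k) = matrix_inv (M (n - int k - 1)) ** evo_bwd M n k"

definition evol :: "(int \<Rightarrow> real^'p^'p) \<Rightarrow> int \<Rightarrow> int \<Rightarrow> real^'p^'p" where
  "evol M m n = (if n \<le> m then evo_fwd M n (nat (m - n)) else evo_bwd M n (nat (n - m)))"

definition mnorm :: "real^'q^'p \<Rightarrow> real" where
  "mnorm X = onorm (\<lambda>x. X *v x)"

definition has_ED :: "int set \<Rightarrow> (int \<Rightarrow> real^'p^'p) \<Rightarrow> bool" where
  "has_ED T M \<longleftrightarrow> (\<exists>K \<alpha> P. K > 0 \<and> \<alpha> > 0 \<and>
      (\<forall>n\<in>T. P n ** P n = P n) \<and>
      (\<forall>m\<in>T. \<forall>n\<in>T. P m ** evol M m n = evol M m n ** P n) \<and>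
      (\<forall>m\<in>T. \<forall>n\<in>T. n \<le> m \<longrightarrow>
          mnorm (evol M m n ** P n) \<le> K * exp (- \<alpha> * real_of_int (m - n))) \<and>
      (\<forall>m\<in>T. \<forall>n\<in>T. m \<le> n \<longrightarrow>
          mnorm (evol M m n ** (mat 1 - P n)) \<le> K * exp (\<alpha> * real_of_int (m - n))))"

definition ED_spectrum :: "int set \<Rightarrow> (int \<Rightarrow> real^'p^'p) \<Rightarrow> real set" where
  "ED_spectrum T M = {\<gamma>. \<not> has_ED T (\<lambda>n. exp (- \<gamma>) *\<^sub>R M n)}"

abbreviation "Sigma_ED M \<equiv> ED_spectrum UNIV M"
abbreviation "Sigma_ED_plus M \<equiv> ED_spectrum {0..} M"
abbreviation "Sigma_ED_minus M \<equiv> ED_spectrum {..0} M"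

definition block_upper ::
  "real^'k^'k \<Rightarrow> real^'m^'k \<Rightarrow> real^'m^'m \<Rightarrow> real^('k + 'm)^('k + 'm)" where
  "block_upper A C B = (\<chi> i j. case i of
      Inl a \<Rightarrow> (case j of Inl b \<Rightarrow> A $ a $ b | Inr b \<Rightarrow> C $ a $ b)
    | Inr a \<Rightarrow> (case j of Inl b \<Rightarrow> 0 | Inr b \<Rightarrow> B $ a $ b))"

end

theory Submission
  imports Defs
begin

text \<open>The evolution operator of the triangular system has the form
  \<open>block_upper \<Phi> Y \<Psi>\<close>, where \<open>\<Phi>\<close> and \<open>\<Psi>\<close> are the evolution operators of the diagonal systems.

  Suppose the triangular system has a dichotomy. On the half line \<open>{0..}\<close> the projection at time 0 may be
  replaced by any projection with the same range, in particular by one that preserves the invariant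
  subspace of the first block. The projections are then block triangular, and their diagonal blocks are
  dichotomy projections for \<open>\<Phi>\<close> and \<open>\<Psi>\<close>. The half line \<open>{..0}\<close> follows by reversing time, which exchanges
  a projection and its complement.

  Conversely, let \<open>P\<close> and \<open>R\<close> be dichotomy projections of \<open>\<Phi>\<close> and \<open>\<Psi>\<close> on the whole line. The two components
  \<open>(1 - P) Y R\<close> and \<open>P Y (1 - R)\<close> of the coupling, which mix the stable and unstable directions, have the form
  \<open>\<Phi>(m,n) H(n) - H(m) \<Psi>(m,n)\<close> and \<open>\<Phi>(m,n) H'(n) - H'(m) \<Psi>(m,n)\<close> with bounded \<open>H\<close> and \<open>H'\<close>, so that
  \<open>block_upper P (H' - H) R\<close> is invariant. The remaining components \<open>P Y R\<close> and \<open>(1 - P) Y (1 - R)\<close> decay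
  at any rate smaller than that of the diagonal systems, by the variation of constants formula.\<close>

section \<open>Matrix algebra and the operator norm\<close>

lemma bounded_bilinear_matrix_mult:
  "bounded_bilinear ((**) :: real^'n^'m \<Rightarrow> real^'p^'n \<Rightarrow> real^'p^'m)"
  unfolding bilinear_conv_bounded_bilinear[symmetric] bilinear_def
  by (auto intro!: linearI simp: matrix_matrix_mult_def vec_eq_iff algebra_simps sum.distrib sum_distrib_left)

interpretation matrix_mult: bounded_bilinear "(**) :: real^'n^'m \<Rightarrow> real^'p^'n \<Rightarrow> real^'p^'m"
  by (rule bounded_bilinear_matrix_mult)

lemmas matrix_distribs =
  matrix_mult.add_left matrix_mult.add_right matrix_mult.diff_left matrix_mult.diff_right
  matrix_mult.minus_left matrix_mult.minus_right

text \<open>Left-associated products hide adjacent factors \<open>A ** B\<close> inside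
  \<open>X ** A ** B\<close>; this turns an equation for the pair into a rewrite rule for that
  form.\<close>

lemma matrix_mul_left_cong: "A ** B = C \<Longrightarrow> X ** A ** B = X ** C"
  by (simp add: matrix_mul_assoc[symmetric])

lemma matrix_inv_mult_left [simp]: "invertible A \<Longrightarrow> matrix_inv A ** A = mat 1"
  and matrix_inv_mult_right [simp]: "invertible A \<Longrightarrow> A ** matrix_inv A = mat 1"
  unfolding invertible_def matrix_inv_def by (rule someI2_ex; blast)+

lemma matrix_inv_eqI:
  assumes "A ** B = mat 1" "B ** A = mat 1"
  shows "matrix_inv A = B"
proof -
  have "invertible A" using assms unfolding invertible_def by blast
  then have "matrix_inv A ** A ** B = B" by simp
  then show ?thesis by (simp add: matrix_mul_assoc[symmetric] assms)
qed

section \<open>Estimates for the operator norm\<close>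

lemma mnorm_nonneg: "0 \<le> mnorm X"
  by (simp add: mnorm_def onorm_pos_le)

lemma norm_matrix_vector_le_mnorm: "norm (X *v x) \<le> mnorm X * norm x"
  by (simp add: mnorm_def onorm)

lemma mnorm_leI: "(\<And>x. norm (X *v x) \<le> b * norm x) \<Longrightarrow> mnorm X \<le> b"
  unfolding mnorm_def by (rule onorm_le)

lemma mnorm_mult_mono:
  assumes "mnorm X \<le> a" "mnorm Y \<le> b"
  shows "mnorm (X ** Y) \<le> a * b"
proof (rule mnorm_leI)
  fix x
  have "norm (X ** Y *v x) \<le> mnorm X * norm (Y *v x)"
    by (metis matrix_vector_mul_assoc norm_matrix_vector_le_mnorm)
  also have "\<dots> \<le> a * (b * norm x)"
  proof (rule mult_mono)
    show "norm (Y *v x) \<le> b * norm x"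
      by (rule order_trans[OF norm_matrix_vector_le_mnorm]) (simp add: assms mult_right_mono)
  qed (use assms mnorm_nonneg[of X] in auto)
  finally show "norm (X ** Y *v x) \<le> a * b * norm x" by (simp add: mult.assoc)
qed

lemma mnorm_minus [simp]: "mnorm (- X) = mnorm X"
proof -
  have "(*v) (- X) = (\<lambda>x. - (X *v x))"
    by (simp add: fun_eq_iff vec_eq_iff matrix_vector_mult_def sum_negf)
  then show ?thesis by (simp add: mnorm_def onorm_neg)
qed

lemma mnorm_add_mono:
  assumes "mnorm X \<le> a" "mnorm Y \<le> b"
  shows "mnorm (X + Y) \<le> a + b"
proof (rule mnorm_leI)
  fix x
  have "norm ((X + Y) *v x) \<le> norm (X *v x) + norm (Y *v x)"
    by (simp add: matrix_vector_mult_add_rdistrib norm_triangle_ineq)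
  also have "\<dots> \<le> mnorm X * norm x + mnorm Y * norm x"
    by (intro add_mono norm_matrix_vector_le_mnorm)
  also have "\<dots> \<le> (a + b) * norm x"
    using assms by (simp add: distrib_right add_mono mult_right_mono)
  finally show "norm ((X + Y) *v x) \<le> (a + b) * norm x" .
qed

lemma mnorm_diff_mono: "mnorm X \<le> a \<Longrightarrow> mnorm Y \<le> b \<Longrightarrow> mnorm (X - Y) \<le> a + b"
  using mnorm_add_mono[of X a "- Y" b] by simp

lemma mnorm_sum_le: "mnorm (sum f S) \<le> (\<Sum>i\<in>S. mnorm (f i))"
proof (induction S rule: infinite_finite_induct)
  case (insert x F)
  then show ?case by (simp add: mnorm_add_mono)
qed (simp_all add: mnorm_def onorm_zero)

lemma mnorm_le_norm: "mnorm (X :: real^'q^'p) \<le> real CARD('p) * real CARD('q) * norm X"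
  unfolding mnorm_def
proof (rule onorm_le_matrix_component)
  fix i j
  have "\<bar>X $ i $ j\<bar> \<le> norm (X $ i)" by (rule component_le_norm_cart)
  also have "\<dots> \<le> norm X" by (rule Finite_Cartesian_Product.norm_nth_le)
  finally show "\<bar>X $ i $ j\<bar> \<le> norm X" .
qed

text \<open>Dichotomy estimates use \<open>mnorm\<close>, whereas bounded sequences and convergence
  refer to the Euclidean norm; together with \<open>mnorm_le_norm\<close> this permits passage both
  ways.\<close>

lemma norm_le_mnorm: "norm (X :: real^'q^'p) \<le> real CARD('p) * real CARD('q) * mnorm X"
proof -
  have "norm X \<le> (\<Sum>i\<in>UNIV. norm (X $ i))"
    unfolding norm_vec_def by (rule L2_set_le_sum) simp
  also have "\<dots> \<le> (\<Sum>i\<in>(UNIV::'p set). \<Sum>j\<in>(UNIV::'q set). mnorm X)"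
    by (intro sum_mono order_trans[OF norm_le_l1_cart])
      (simp add: mnorm_def matrix_component_le_onorm)
  finally show ?thesis by (simp add: mult.assoc)
qed

lemma bounded_seq_mnorm:
  assumes "bounded_seq T M"
  obtains b where "\<And>n. n \<in> T \<Longrightarrow> mnorm (M n) \<le> b"
proof -
  obtain a where a: "\<And>n. n \<in> T \<Longrightarrow> norm (M n) \<le> a"
    using assms by (auto simp: bounded_seq_def bounded_iff)
  show thesis
  proof
    show "mnorm (M n) \<le> real CARD('b) * real CARD('a) * a" if "n \<in> T" for n
      by (rule order_trans[OF mnorm_le_norm]) (simp add: a that mult_left_mono)
  qed
qed

section \<open>Block upper triangular matrices\<close>

lemma sum_UNIV_sum:
  "(\<Sum>i\<in>(UNIV :: ('k::finite + 'm::finite) set). f i) = (\<Sum>i\<in>UNIV. f (Inl i)) + (\<Sum>i\<in>UNIV. f (Inr i))"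
  by (simp add: UNIV_Plus_UNIV[symmetric] sum.Plus del: UNIV_Plus_UNIV)

lemma vec_sum_eq_iff:
  "v = w \<longleftrightarrow> (\<forall>i. v $ Inl i = w $ Inl i) \<and> (\<forall>i. v $ Inr i = w $ Inr i)"
  by (metis obj_sumE vec_eq_iff)

lemma block_upper_nth [simp]:
  "block_upper A C B $ Inl i $ Inl j = A $ i $ j"
  "block_upper A C B $ Inl i $ Inr l = C $ i $ l"
  "block_upper A C B $ Inr l $ Inl j = 0"
  "block_upper A C B $ Inr l $ Inr h = B $ l $ h"
  by (simp_all add: block_upper_def)

lemma block_upper_eq_iff [simp]:
  "block_upper A C B = block_upper A' C' B' \<longleftrightarrow> A = A' \<and> C = C' \<and> B = B'"
  by (auto simp: vec_sum_eq_iff) (auto simp: vec_eq_iff)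

lemma block_upper_mult [simp]:
  "block_upper A C B ** block_upper A' C' B' =
   block_upper (A ** A') (A ** C' + C ** B') (B ** B')"
  by (simp add: vec_sum_eq_iff matrix_matrix_mult_def sum_UNIV_sum)

lemma block_upper_diff [simp]:
  "block_upper A C B - block_upper A' C' B' = block_upper (A - A') (C - C') (B - B')"
  by (simp add: vec_sum_eq_iff)

lemma block_upper_scaleR [simp]:
  "r *\<^sub>R block_upper A C B = block_upper (r *\<^sub>R A) (r *\<^sub>R C) (r *\<^sub>R B)"
  by (simp add: vec_sum_eq_iff)

lemma mat_1_block_upper: "mat 1 = block_upper (mat 1) 0 (mat 1)"
  by (simp add: vec_sum_eq_iff mat_def)

lemma block_upperI:
  assumes "\<And>i j. S $ Inr i $ Inl j = 0"
  obtains A C B where "S = block_upper A C B"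
proof
  show "S = block_upper (\<chi> i j. S $ Inl i $ Inl j) (\<chi> i j. S $ Inl i $ Inr j) (\<chi> i j. S $ Inr i $ Inr j)"
    using assms by (simp add: vec_sum_eq_iff)
qed

lemma block_upper_matrix_inv:
  assumes "invertible A" "invertible B"
  shows "invertible (block_upper A C B)"
    and "matrix_inv (block_upper A C B) =
         block_upper (matrix_inv A) (- (matrix_inv A ** C ** matrix_inv B)) (matrix_inv B)"
      (is "_ = ?J")
proof -
  have 1: "block_upper A C B ** ?J = mat 1"
    using assms by (simp add: mat_1_block_upper matrix_distribs matrix_mul_assoc)
  have 2: "?J ** block_upper A C B = mat 1"
    using assms
    by (simp add: mat_1_block_upper matrix_distribs matrix_mul_assoc[symmetric])
  show "invertible (block_upper A C B)" using 1 2 unfolding invertible_def by blast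
  show "matrix_inv (block_upper A C B) = ?J" using 1 2 by (rule matrix_inv_eqI)
qed

section \<open>Vectors split along the blocks, and norms of block matrices\<close>

definition join_vec :: "real^'k \<Rightarrow> real^'m \<Rightarrow> real^('k + 'm)" where
  "join_vec x y = (\<chi> i. case i of Inl a \<Rightarrow> x $ a | Inr b \<Rightarrow> y $ b)"

lemma join_vec_nth [simp]: "join_vec x y $ Inl i = x $ i" "join_vec x y $ Inr j = y $ j"
  by (simp_all add: join_vec_def)

lemma join_vec_cases: obtains x y where "v = join_vec x y"
proof
  show "v = join_vec (\<chi> i. v $ Inl i) (\<chi> i. v $ Inr i)" by (simp add: vec_sum_eq_iff)
qed

lemma norm_join_vec: "norm (join_vec x y) = sqrt ((norm x)\<^sup>2 + (norm y)\<^sup>2)"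
  by (simp add: norm_vec_def L2_set_def sum_UNIV_sum sum_nonneg)

lemma norm_join_vec_ge: "norm x \<le> norm (join_vec x y)" "norm y \<le> norm (join_vec x y)"
  by (simp_all add: norm_join_vec)

lemma block_upper_mult_join_vec:
  "block_upper A C B *v join_vec x y = join_vec (A *v x + C *v y) (B *v y)"
  by (simp add: vec_sum_eq_iff matrix_vector_mult_def sum_UNIV_sum)

lemma mnorm_diag_le_block_upper:
  shows "mnorm A \<le> mnorm (block_upper A C B)" and "mnorm B \<le> mnorm (block_upper A C B)"
proof -
  show "mnorm A \<le> mnorm (block_upper A C B)"
  proof (rule mnorm_leI)
    fix x
    have "norm (A *v x) \<le> norm (block_upper A C B *v join_vec x 0)"
      by (simp add: block_upper_mult_join_vec norm_join_vec_ge)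
    also have "\<dots> \<le> mnorm (block_upper A C B) * norm (join_vec x (0::real^'b))"
      by (rule norm_matrix_vector_le_mnorm)
    finally show "norm (A *v x) \<le> mnorm (block_upper A C B) * norm x"
      by (simp add: norm_join_vec)
  qed
  show "mnorm B \<le> mnorm (block_upper A C B)"
  proof (rule mnorm_leI)
    fix y
    have "norm (B *v y) \<le> norm (block_upper A C B *v join_vec 0 y)"
      by (simp add: block_upper_mult_join_vec norm_join_vec_ge)
    also have "\<dots> \<le> mnorm (block_upper A C B) * norm (join_vec (0::real^'a) y)"
      by (rule norm_matrix_vector_le_mnorm)
    finally show "norm (B *v y) \<le> mnorm (block_upper A C B) * norm y"
      by (simp add: norm_join_vec)
  qed
qed

lemma mnorm_block_upper_le:
  assumes "mnorm A \<le> a" "mnorm C \<le> c" "mnorm B \<le> b"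
  shows "mnorm (block_upper A C B) \<le> a + c + b"
proof (rule mnorm_leI)
  fix v :: "real^('a + 'b)"
  obtain x y where v: "v = join_vec x y" by (rule join_vec_cases)
  have nn: "0 \<le> a" "0 \<le> c" "0 \<le> b"
    using assms mnorm_nonneg order_trans by blast+
  have "norm (block_upper A C B *v v) \<le> norm (A *v x + C *v y) + norm (B *v y)"
    unfolding v block_upper_mult_join_vec norm_join_vec by (rule sqrt_sum_squares_le_sum) simp_all
  also have "\<dots> \<le> norm (A *v x) + norm (C *v y) + norm (B *v y)"
    by (simp add: norm_triangle_ineq)
  also have "\<dots> \<le> mnorm A * norm x + mnorm C * norm y + mnorm B * norm y"
    by (intro add_mono norm_matrix_vector_le_mnorm)
  also have "\<dots> \<le> a * norm v + c * norm v + b * norm v"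
    unfolding v by (intro add_mono mult_mono assms norm_join_vec_ge nn) auto
  finally show "norm (block_upper A C B *v v) \<le> (a + c + b) * norm v"
    by (simp add: algebra_simps)
qed

section \<open>Cocycles and dichotomies\<close>

text \<open>Abstracted from \<open>evol\<close> so that the time-reversed family is again an
  instance.\<close>

definition cocycle :: "(int \<Rightarrow> int \<Rightarrow> real^'p^'p) \<Rightarrow> bool" where
  "cocycle \<Phi> \<longleftrightarrow> (\<forall>n. \<Phi> n n = mat 1) \<and> (\<forall>m n l. \<Phi> m n ** \<Phi> n l = \<Phi> m l)"

text \<open>The body of \<open>has_ED\<close> with constants and projections exposed and an
  arbitrary family in place of \<open>evol M\<close>.\<close>

definition dichotomy ::
  "int set \<Rightarrow> (int \<Rightarrow> int \<Rightarrow> real^'p^'p) \<Rightarrow> (int \<Rightarrow> real^'p^'p) \<Rightarrow> real \<Rightarrow> real \<Rightarrow> bool" where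
  "dichotomy T \<Phi> P K \<alpha> \<longleftrightarrow>
      (\<forall>n\<in>T. P n ** P n = P n) \<and>
      (\<forall>m\<in>T. \<forall>n\<in>T. P m ** \<Phi> m n = \<Phi> m n ** P n) \<and>
      (\<forall>m\<in>T. \<forall>n\<in>T. n \<le> m \<longrightarrow>
          mnorm (\<Phi> m n ** P n) \<le> K * exp (- \<alpha> * real_of_int (m - n))) \<and>
      (\<forall>m\<in>T. \<forall>n\<in>T. m \<le> n \<longrightarrow>
          mnorm (\<Phi> m n ** (mat 1 - P n)) \<le> K * exp (\<alpha> * real_of_int (m - n)))"

lemma has_ED_iff_dichotomy:
  "has_ED T M \<longleftrightarrow> (\<exists>K \<alpha> P. K > 0 \<and> \<alpha> > 0 \<and> dichotomy T (evol M) P K \<alpha>)"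
  by (simp only: has_ED_def dichotomy_def)

lemma dichotomyD:
  assumes "dichotomy T \<Phi> P K \<alpha>" "m \<in> T" "n \<in> T"
  shows "P n ** P n = P n"
    and "P m ** \<Phi> m n = \<Phi> m n ** P n"
    and "n \<le> m \<Longrightarrow> mnorm (\<Phi> m n ** P n) \<le> K * exp (- \<alpha> * real_of_int (m - n))"
    and "m \<le> n \<Longrightarrow> mnorm (\<Phi> m n ** (mat 1 - P n)) \<le> K * exp (\<alpha> * real_of_int (m - n))"
  using assms unfolding dichotomy_def by blast+

lemma dichotomy_subset: "dichotomy T \<Phi> P K \<alpha> \<Longrightarrow> S \<subseteq> T \<Longrightarrow> dichotomy S \<Phi> P K \<alpha>"
  unfolding dichotomy_def by blast

lemma dichotomy_mono:
  assumes "dichotomy T \<Phi> P K \<alpha>" "K \<le> K'" "\<alpha>' \<le> \<alpha>" "0 \<le> K'"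
  shows "dichotomy T \<Phi> P K' \<alpha>'"
proof -
  have "K * exp (- \<alpha> * real_of_int (m - n)) \<le> K' * exp (- \<alpha>' * real_of_int (m - n))"
    if "n \<le> m" for m n
    using that assms by (intro mult_mono) (auto intro: mult_right_mono)
  moreover have "K * exp (\<alpha> * real_of_int (m - n)) \<le> K' * exp (\<alpha>' * real_of_int (m - n))"
    if "m \<le> n" for m n
    using that assms by (intro mult_mono) (auto intro: mult_right_mono_neg)
  ultimately show ?thesis
    using assms(1) unfolding dichotomy_def by (meson order_trans)
qed

lemma cocycle_uminus: "cocycle \<Phi> \<Longrightarrow> cocycle (\<lambda>m n. \<Phi> (- m) (- n))"
  by (simp add: cocycle_def)

text \<open>Reversal changes the sign of \<open>m - n\<close>, so the two estimates trade places
  once \<open>P\<close> is replaced by its complement.\<close>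

lemma dichotomy_uminus:
  assumes "dichotomy T \<Phi> P K \<alpha>"
  shows "dichotomy (uminus ` T) (\<lambda>m n. \<Phi> (- m) (- n)) (\<lambda>n. mat 1 - P (- n)) K \<alpha>"
proof -
  note D = dichotomyD[OF assms]
  have "(mat 1 - P n) ** (mat 1 - P n) = mat 1 - P n" if "n \<in> T" for n
    using D(1)[OF that that] by (simp add: matrix_distribs)
  moreover have "(mat 1 - P m) ** \<Phi> m n = \<Phi> m n ** (mat 1 - P n)" if "m \<in> T" "n \<in> T" for m n
    using D(2)[OF that] by (simp add: matrix_distribs)
  moreover have "mnorm (\<Phi> m n ** (mat 1 - P n)) \<le> K * exp (- \<alpha> * real_of_int (- m - (- n)))"
    if "m \<in> T" "n \<in> T" "- n \<le> - m" for m n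
    using D(4)[OF that(1,2)] that(3) by (simp add: algebra_simps)
  moreover have "mnorm (\<Phi> m n ** P n) \<le> K * exp (\<alpha> * real_of_int (- m - (- n)))"
    if "m \<in> T" "n \<in> T" "- m \<le> - n" for m n
    using D(3)[OF that(1,2)] that(3) by (simp add: algebra_simps)
  ultimately show ?thesis
    unfolding dichotomy_def ball_simps minus_minus diff_diff_eq2 add_diff_cancel_left' by blast
qed

section \<open>Evolution operators as cocycles\<close>

lemma evol_refl [simp]: "evol M n n = mat 1"
  by (simp add: evol_def)

lemma evol_step:
  assumes "\<And>n. invertible (M n)"
  shows "evol M (m + 1) n = M m ** evol M m n"
proof (cases "n \<le> m")
  case True
  then have "nat (m + 1 - n) = Suc (nat (m - n))" by simp
  then show ?thesis using True by (simp add: evol_def)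
next
  case False
  then have k: "nat (n - m) = Suc (nat (n - (m + 1)))" by simp
  have "evol M m n = matrix_inv (M m) ** evo_bwd M n (nat (n - (m + 1)))"
    using False by (simp add: evol_def k)
  \<comment> \<open>For \<open>m + 1 = n\<close> the definition of \<open>evol\<close> changes
    branch: zero forward steps agree with zero backward steps.\<close>
  also have "evo_bwd M n (nat (n - (m + 1))) = evol M (m + 1) n"
    using False by (auto simp: evol_def)
  finally show ?thesis using assms by (simp add: matrix_mul_assoc)
qed

lemma evol_step_back:
  assumes "\<And>n. invertible (M n)"
  shows "evol M (m - 1) n = matrix_inv (M (m - 1)) ** evol M m n"
  using evol_step[of M "m - 1" n] assms by (simp add: matrix_mul_assoc)

lemma cocycle_evol:
  assumes "\<And>n. invertible (M n)"
  shows "cocycle (evol M)"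
proof -
  have "evol M m n ** evol M n l = evol M m l" for m n l
  proof (induction m rule: int_induct[of _ n])
    case (step1 i)
    then show ?case using assms by (simp add: evol_step matrix_mul_assoc[symmetric])
  next
    case (step2 i)
    then show ?case using assms by (simp add: evol_step_back matrix_mul_assoc[symmetric])
  qed simp
  then show ?thesis by (simp add: cocycle_def)
qed

text \<open>Each step in either direction keeps the block shape. Of the coupling \<open>Y\<close>
  only the one-step values are recorded; bounds on these are what the variation of constants
  estimates consume.\<close>

lemma evol_block_upper:
  assumes "\<And>n. invertible (A n)" "\<And>n. invertible (B n)"
  obtains Y where "evol (\<lambda>n. block_upper (A n) (C n) (B n)) =
      (\<lambda>m n. block_upper (evol A m n) (Y m n) (evol B m n))"
    "\<And>n. Y (n + 1) n = C n" "\<And>n. Y n (n + 1) = - (matrix_inv (A n) ** C n ** matrix_inv (B n))"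
proof -
  let ?D = "\<lambda>n. block_upper (A n) (C n) (B n)"
  have D: "\<And>n. invertible (?D n)" by (simp add: assms block_upper_matrix_inv)
  have "\<exists>Y. evol ?D m n = block_upper (evol A m n) Y (evol B m n)" for m n
  proof (induction m rule: int_induct[of _ n])
    case base
    then show ?case by (auto simp: mat_1_block_upper)
  next
    case (step1 i)
    then show ?case using D assms by (auto simp: evol_step)
  next
    case (step2 i)
    then show ?case using D assms by (auto simp: evol_step_back block_upper_matrix_inv)
  qed
  then obtain Y where Y: "\<And>m n. evol ?D m n = block_upper (evol A m n) (Y m n) (evol B m n)"
    by metis
  show thesis
  proof
    show "evol ?D = (\<lambda>m n. block_upper (evol A m n) (Y m n) (evol B m n))"
      by (simp add: fun_eq_iff Y)
    show "Y (n + 1) n = C n" for n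
      using evol_step[of ?D n n] Y[of "n + 1" n] D by simp
    show "Y n (n + 1) = - (matrix_inv (A n) ** C n ** matrix_inv (B n))" for n
      using evol_step_back[of ?D "n + 1" "n + 1"] Y[of n "n + 1"] D assms
      by (simp add: block_upper_matrix_inv)
  qed
qed

section \<open>Half lines: restricting a dichotomy to the diagonal blocks\<close>

text \<open>On a half line only the range of the projection at time 0 matters: replacing the projection by
  another one with the same range adds a term that decays in both time arguments.\<close>

lemma dichotomy_same_range:
  assumes \<Phi>: "cocycle \<Phi>" and P: "dichotomy {0..} \<Phi> P K \<alpha>" and "K > 0" "\<alpha> > 0"
    and S: "P 0 ** S = S" "S ** P 0 = P 0"
  shows "dichotomy {0..} \<Phi> (\<lambda>n. \<Phi> n 0 ** S ** \<Phi> 0 n) (K + K * mnorm (S - P 0) * K) \<alpha>"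
proof -
  note D = dichotomyD[OF P]
  have c: "\<Phi> n n = mat 1" "\<Phi> m n ** \<Phi> n l = \<Phi> m l" for m n l
    using \<Phi> by (auto simp: cocycle_def)
  note c' = c(2)[THEN matrix_mul_left_cong]
  have SS: "S ** S = S" by (metis S matrix_mul_assoc)
  \<comment> \<open>The range conditions give
    \<open>S - P 0 = P 0 ** (S - P 0) ** (mat 1 - P 0)\<close>, so the correction factors through
    stable decay from 0 to \<open>m\<close> and unstable decay from \<open>n\<close> back to
    0.\<close>
  define W where "W m n = (\<Phi> m 0 ** P 0) ** (S - P 0) ** (\<Phi> 0 n ** (mat 1 - P n))" for m n
  have W: "\<Phi> m n ** (\<Phi> n 0 ** S ** \<Phi> 0 n) = \<Phi> m n ** P n + W m n" if "0 \<le> n" for m n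
  proof -
    have P0: "P 0 ** P 0 = P 0" and inv: "\<Phi> 0 n ** P n = P 0 ** \<Phi> 0 n"
      using D(1,2)[of 0 n] D(1)[of 0 0] that by auto
    have "W m n = \<Phi> m 0 ** S ** \<Phi> 0 n - \<Phi> m 0 ** P 0 ** \<Phi> 0 n"
      unfolding W_def
      by (simp add: matrix_distribs matrix_mul_assoc inv[THEN matrix_mul_left_cong]
          S[THEN matrix_mul_left_cong] P0[THEN matrix_mul_left_cong])
    also have "\<Phi> m 0 ** P 0 ** \<Phi> 0 n = \<Phi> m n ** P n"
      by (simp add: inv[symmetric] matrix_mul_assoc[symmetric]) (simp add: matrix_mul_assoc c)
    finally show ?thesis by (simp add: matrix_mul_assoc c)
  qed
  have Wn: "mnorm (W m n) \<le> K * mnorm (S - P 0) * K * exp (- \<alpha> * real_of_int (m + n))"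
    if "0 \<le> m" "0 \<le> n" for m n
  proof -
    have "mnorm (W m n) \<le> (K * exp (- \<alpha> * real_of_int (m - 0))) * mnorm (S - P 0)
        * (K * exp (\<alpha> * real_of_int (0 - n)))"
      unfolding W_def using that by (intro mnorm_mult_mono D order_refl) auto
    also have "\<dots> = K * mnorm (S - P 0) * K * exp (- \<alpha> * real_of_int (m + n))"
      by (simp add: algebra_simps mult_exp_exp)
    finally show ?thesis .
  qed
  have KS: "0 \<le> K * mnorm (S - P 0) * K" using \<open>K > 0\<close> by (simp add: mnorm_nonneg)
  show ?thesis
    unfolding dichotomy_def
  proof (intro conjI ballI impI)
    fix n :: int
    show "\<Phi> n 0 ** S ** \<Phi> 0 n ** (\<Phi> n 0 ** S ** \<Phi> 0 n) = \<Phi> n 0 ** S ** \<Phi> 0 n"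
      by (simp add: matrix_mul_assoc c c' SS[THEN matrix_mul_left_cong])
  next
    fix m n :: int
    show "\<Phi> m 0 ** S ** \<Phi> 0 m ** \<Phi> m n = \<Phi> m n ** (\<Phi> n 0 ** S ** \<Phi> 0 n)"
      by (simp add: matrix_mul_assoc c c')
    assume mn: "m \<in> {0..}" "n \<in> {0..}"
    { assume "n \<le> m"
      have "mnorm (\<Phi> m n ** (\<Phi> n 0 ** S ** \<Phi> 0 n)) \<le>
          K * exp (- \<alpha> * real_of_int (m - n)) + K * mnorm (S - P 0) * K * exp (- \<alpha> * real_of_int (m + n))"
        using mn \<open>n \<le> m\<close> W[of n m] by (simp only: atLeast_iff) (intro mnorm_add_mono D(3) Wn; simp)
      \<comment> \<open>Here the half line matters: \<open>m + n\<close> dominates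
        \<open>m - n\<close> and, in the second estimate, \<open>n - m\<close>.\<close>
      also have "\<dots> \<le> K * exp (- \<alpha> * real_of_int (m - n)) + K * mnorm (S - P 0) * K * exp (- \<alpha> * real_of_int (m - n))"
        using mn \<open>\<alpha> > 0\<close> KS by (intro add_left_mono mult_left_mono) auto
      finally show "mnorm (\<Phi> m n ** (\<Phi> n 0 ** S ** \<Phi> 0 n)) \<le>
          (K + K * mnorm (S - P 0) * K) * exp (- \<alpha> * real_of_int (m - n))"
        by (simp add: distrib_right) }
    { assume "m \<le> n"
      have "\<Phi> m n ** (mat 1 - \<Phi> n 0 ** S ** \<Phi> 0 n) = \<Phi> m n ** (mat 1 - P n) - W m n"
        using W[of n m] mn by (simp add: matrix_mult.diff_right)
      also have "mnorm \<dots> \<le>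
          K * exp (\<alpha> * real_of_int (m - n)) + K * mnorm (S - P 0) * K * exp (- \<alpha> * real_of_int (m + n))"
        using mn \<open>m \<le> n\<close> by (intro mnorm_diff_mono D(4) Wn) auto
      also have "\<dots> \<le> K * exp (\<alpha> * real_of_int (m - n)) + K * mnorm (S - P 0) * K * exp (\<alpha> * real_of_int (m - n))"
      proof -
        have "- \<alpha> * real_of_int (m + n) \<le> \<alpha> * real_of_int (m - n)"
          using mn \<open>\<alpha> > 0\<close> by (simp add: algebra_simps)
        then show ?thesis using KS by (intro add_left_mono mult_left_mono) auto
      qed
      finally show "mnorm (\<Phi> m n ** (mat 1 - \<Phi> n 0 ** S ** \<Phi> 0 n)) \<le>
          (K + K * mnorm (S - P 0) * K) * exp (\<alpha> * real_of_int (m - n))"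
        by (simp add: distrib_right) }
  qed
qed

text \<open>Subtracting \<open>P g (1 - P)\<close> from \<open>P\<close> changes the kernel but not
  the range. If \<open>g\<close> is a linear section of \<open>mat 1 - P\<close> over the image of
  \<open>V\<close>, with values in \<open>V\<close>, then \<open>S *v v = v - g w\<close> for
  \<open>v\<close> in \<open>V\<close> and \<open>w = (mat 1 - P) *v v\<close>, a difference of
  vectors of \<open>V\<close>.\<close>

lemma exists_projection_preserving_subspace:
  fixes P :: "real^'n^'n"
  assumes P: "P ** P = P" and V: "subspace V"
  obtains S where "P ** S = S" "S ** P = P" "\<And>v. v \<in> V \<Longrightarrow> S *v v \<in> V"
proof -
  obtain g where g: "range g \<subseteq> V" "linear g"
    "\<And>w. w \<in> (*v) (mat 1 - P) ` V \<Longrightarrow> (mat 1 - P) *v g w = w"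
    using linear_exists_right_inverse_on[OF matrix_vector_mul_linear V, of "mat 1 - P"] by blast
  define S where "S = P - P ** matrix g ** (mat 1 - P)"
  show thesis
  proof
    show "P ** S = S" by (simp add: S_def matrix_distribs matrix_mul_assoc P)
    show "S ** P = P"
      by (simp add: S_def matrix_distribs matrix_mul_assoc P P[THEN matrix_mul_left_cong])
    fix v assume v: "v \<in> V"
    define w where "w = (mat 1 - P) *v v"
    have w: "g w - P *v g w = w"
      using g(3)[of w] v by (simp add: w_def matrix_vector_mult_diff_rdistrib)
    have "S *v v = P *v v - P *v g w"
      by (simp add: S_def w_def matrix_vector_mult_diff_rdistrib matrix_works g(2)
          matrix_vector_mul_assoc[symmetric])
    also have "\<dots> = v - g w"
      using w by (simp add: w_def algebra_simps)
    finally show "S *v v \<in> V" using g(1) v V by (auto intro: subspace_diff)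
  qed
qed

text \<open>Corner entries never enter the diagonal blocks of a product, and a diagonal block has
  norm at most that of the whole matrix.\<close>

lemma dichotomy_block_upper_diag:
  assumes "dichotomy T (\<lambda>m n. block_upper (\<Phi> m n) (Y m n) (\<Psi> m n))
      (\<lambda>n. block_upper (P n) (X n) (R n)) K \<alpha>"
  shows "dichotomy T \<Phi> P K \<alpha>" and "dichotomy T \<Psi> R K \<alpha>"
  using assms
  unfolding dichotomy_def mat_1_block_upper block_upper_mult block_upper_diff block_upper_eq_iff
  by (blast intro: order_trans[OF mnorm_diag_le_block_upper(1)]
      order_trans[OF mnorm_diag_le_block_upper(2)])+

lemma block_upper_dichotomy_half_line:
  fixes \<Phi> :: "int \<Rightarrow> int \<Rightarrow> real^'k^'k" and \<Psi> :: "int \<Rightarrow> int \<Rightarrow> real^'m^'m"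
  assumes c: "cocycle (\<lambda>m n. block_upper (\<Phi> m n) (Y m n) (\<Psi> m n))"
    and D: "dichotomy {0..} (\<lambda>m n. block_upper (\<Phi> m n) (Y m n) (\<Psi> m n)) P K \<alpha>" and "K > 0" "\<alpha> > 0"
  obtains L P' R' where "L > 0" "dichotomy {0..} \<Phi> P' L \<alpha>" "dichotomy {0..} \<Psi> R' L \<alpha>"
proof -
  let ?V = "{v :: real^('k + 'm). \<forall>i. v $ Inr i = 0}"
  have "subspace ?V" by (simp add: subspace_def)
  then obtain S where S: "P 0 ** S = S" "S ** P 0 = P 0" "\<And>v. v \<in> ?V \<Longrightarrow> S *v v \<in> ?V"
    using exists_projection_preserving_subspace[of "P 0" ?V] dichotomyD(1)[OF D, of 0 0] by auto
  \<comment> \<open>The columns indexed by \<open>Inl\<close> are images of basis vectors lying in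
    \<open>?V\<close>.\<close>
  have "S $ Inr i $ Inl j = 0" for i j
  proof -
    have "S *v axis (Inl j) 1 \<in> ?V" by (rule S(3)) (simp add: axis_def)
    then show ?thesis by (simp add: matrix_vector_mult_basis column_def)
  qed
  then obtain S1 S2 S3 where S': "S = block_upper S1 S2 S3" by (rule block_upperI)
  have L: "K + K * mnorm (S - P 0) * K > 0"
    using \<open>K > 0\<close> by (intro add_pos_nonneg) (auto simp: mnorm_nonneg)
  \<comment> \<open>With \<open>S\<close> in block form its transports to all times \<open>n\<close>
    are block triangular, so diagonal blocks can be read off.\<close>
  from dichotomy_same_range[OF c D \<open>K > 0\<close> \<open>\<alpha> > 0\<close> S(1,2)]
  show thesis
    by (subst (asm) S', unfold block_upper_mult) (rule that[OF L dichotomy_block_upper_diag])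
qed

section \<open>The whole line: assembling a dichotomy from the diagonal blocks\<close>

lemma tendsto_of_geometric_increments:
  fixes s :: "nat \<Rightarrow> 'a::banach"
  assumes "s 0 = 0" and inc: "\<And>i. norm (s (Suc i) - s i) \<le> a * r ^ i" and r: "0 \<le> r" "r < 1"
  obtains l where "s \<longlonglongrightarrow> l" "norm l \<le> a / (1 - r)"
proof -
  have geo: "(\<lambda>i. a * r ^ i) sums (a / (1 - r))"
    using sums_mult[OF geometric_sums, of r a] r by simp
  have sm: "summable (\<lambda>i. norm (s (Suc i) - s i))"
    by (rule summable_comparison_test[OF _ sums_summable[OF geo]]) (use inc in auto)
  have "(\<lambda>i. \<Sum>j<i. s (Suc j) - s j) \<longlonglongrightarrow> (\<Sum>j. s (Suc j) - s j)"
    by (rule summable_LIMSEQ[OF summable_norm_cancel[OF sm]])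
  moreover have "norm (\<Sum>j. s (Suc j) - s j) \<le> a / (1 - r)"
    using summable_norm[OF sm] suminf_le[OF inc sm sums_summable[OF geo]] sums_unique[OF geo] by simp
  ultimately show thesis
    using that by (simp add: sum_lessThan_telescope assms(1))
qed

text \<open>Limits are estimated along times starting at \<open>n\<close>, but comparing those for
  different starting times requires one common sequence.\<close>

lemma LIMSEQ_int_shift:
  fixes f :: "int \<Rightarrow> 'a::topological_space"
  assumes "(\<lambda>i. f (n + int i)) \<longlonglongrightarrow> l"
  shows "(\<lambda>i. f (int i)) \<longlonglongrightarrow> l"
proof (cases "0 \<le> n")
  case True
  then have "(\<lambda>i. f (int (i + nat n))) \<longlonglongrightarrow> l" using assms by (simp add: add.commute)
  then show ?thesis by (rule LIMSEQ_offset)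
next
  case False
  then show ?thesis using LIMSEQ_ignore_initial_segment[OF assms, of "nat (- n)"] by simp
qed

text \<open>The law assumed for \<open>Y\<close> is the corner entry of the cocycle law of
  \<open>block_upper \<Phi> Y \<Psi>\<close>. One-step bounds in both directions keep the setting
  closed under time reversal.\<close>

locale dichotomous_pair =
  fixes \<Phi> :: "int \<Rightarrow> int \<Rightarrow> real^'k^'k" and \<Psi> :: "int \<Rightarrow> int \<Rightarrow> real^'m^'m"
    and Y :: "int \<Rightarrow> int \<Rightarrow> real^'m^'k"
    and P :: "int \<Rightarrow> real^'k^'k" and R :: "int \<Rightarrow> real^'m^'m" and K \<alpha> c :: real
  assumes \<Phi>: "cocycle \<Phi>" and \<Psi>: "cocycle \<Psi>"
    and Y: "\<And>m n l. Y m l = \<Phi> m n ** Y n l + Y m n ** \<Psi> n l"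
    and P: "dichotomy UNIV \<Phi> P K \<alpha>" and R: "dichotomy UNIV \<Psi> R K \<alpha>"
    and K: "K > 0" and \<alpha>: "\<alpha> > 0"
    and Y_step: "\<And>n. mnorm (Y (n + 1) n) \<le> c" "\<And>n. mnorm (Y n (n + 1)) \<le> c"
begin

lemma reverse: "dichotomous_pair (\<lambda>m n. \<Phi> (- m) (- n)) (\<lambda>m n. \<Psi> (- m) (- n)) (\<lambda>m n. Y (- m) (- n))
    (\<lambda>n. mat 1 - P (- n)) (\<lambda>n. mat 1 - R (- n)) K \<alpha> c"
proof
  show "mnorm (Y (- (n + 1)) (- n)) \<le> c" for n using Y_step(2)[of "- n - 1"] by simp
  show "mnorm (Y (- n) (- (n + 1))) \<le> c" for n using Y_step(1)[of "- n - 1"] by simp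
qed (use dichotomy_uminus[OF P] dichotomy_uminus[OF R] in
    \<open>auto simp: K \<alpha> cocycle_uminus \<Phi> \<Psi> intro: Y\<close>)

lemma c_nonneg: "0 \<le> c"
  using Y_step(1) mnorm_nonneg order_trans by blast

lemma \<Phi>_simps: "\<Phi> n n = mat 1" "\<Phi> m n ** \<Phi> n l = \<Phi> m l"
  using \<Phi> by (auto simp: cocycle_def)

lemma \<Psi>_simps: "\<Psi> n n = mat 1" "\<Psi> m n ** \<Psi> n l = \<Psi> m l"
  using \<Psi> by (auto simp: cocycle_def)

lemma Y_refl: "Y n n = 0"
  using Y[of n n n] by (simp add: \<Phi>_simps \<Psi>_simps)

lemma P_idem: "P n ** P n = P n" and P_inv: "P m ** \<Phi> m n = \<Phi> m n ** P n"
  using dichotomyD(1,2)[OF P] by auto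

lemma R_idem: "R n ** R n = R n" and R_inv: "R m ** \<Psi> m n = \<Psi> m n ** R n"
  using dichotomyD(1,2)[OF R] by auto

text \<open>One summand of the variation of constants formula: the law for \<open>Y\<close> splits
  \<open>Y (q + 1) n\<close> at time \<open>q\<close>, and the part carried by \<Phi> cancels. It
  serves both \<open>U = P\<close> and its complement.\<close>

lemma increment:
  assumes U: "\<And>m n. U m ** \<Phi> m n = \<Phi> m n ** U n"
  shows "\<Phi> m (q + 1) ** U (q + 1) ** Y (q + 1) n ** R n - \<Phi> m q ** U q ** Y q n ** R n
    = (\<Phi> m (q + 1) ** U (q + 1)) ** Y (q + 1) q ** (\<Psi> q n ** R n)"
  unfolding Y[of "q + 1" n q]
  by (simp add: matrix_distribs matrix_mul_assoc U[THEN matrix_mul_left_cong] \<Phi>_simps)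

text \<open>Each of the \<open>m - n\<close> summands decays at the full rate \<alpha>; their number
  is absorbed by giving up half the rate.\<close>

lemma stable_part_bound:
  assumes "n \<le> m"
  shows "mnorm (P m ** Y m n ** R n) \<le> K * c * K * exp \<alpha> * (2 / \<alpha>) * exp (- (\<alpha> / 2) * real_of_int (m - n))"
proof -
  define N where "N = nat (m - n)"
  have m: "m = n + int N" using assms by (simp add: N_def)
  define f where "f i = \<Phi> m (n + int i) ** P (n + int i) ** Y (n + int i) n ** R n" for i
  have inc: "mnorm (f (Suc i) - f i) \<le> K * c * K * exp \<alpha> * exp (- \<alpha> * real N)" if "i < N" for i
  proof -
    have "f (Suc i) - f i = (\<Phi> m (n + int i + 1) ** P (n + int i + 1)) ** Y (n + int i + 1) (n + int i)
        ** (\<Psi> (n + int i) n ** R n)"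
      using increment[of P m "n + int i" n] P_inv by (simp add: f_def algebra_simps)
    also have "mnorm \<dots> \<le> (K * exp (- \<alpha> * real_of_int (m - (n + int i + 1)))) * c
        * (K * exp (- \<alpha> * real_of_int (n + int i - n)))"
      using that by (intro mnorm_mult_mono Y_step dichotomyD(3)[OF P] dichotomyD(3)[OF R]) (auto simp: m)
    \<comment> \<open>The step from \<open>n + i\<close> to \<open>n + i + 1\<close> brings no
      decay, which costs the factor \<open>exp \<alpha>\<close>.\<close>
    also have "\<dots> = K * c * K * exp \<alpha> * exp (- \<alpha> * real N)"
      by (simp add: m mult_exp_exp algebra_simps)
    finally show ?thesis .
  qed
  \<comment> \<open>The sum telescopes to \<open>f N - f 0\<close>, and \<open>f 0 = 0\<close>
    because \<open>Y n n = 0\<close>.\<close>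
  have "P m ** Y m n ** R n = (\<Sum>i<N. f (Suc i) - f i)"
    by (subst sum_lessThan_telescope) (simp add: f_def m[symmetric] \<Phi>_simps Y_refl)
  also have "mnorm \<dots> \<le> (\<Sum>i<N. K * c * K * exp \<alpha> * exp (- \<alpha> * real N))"
    by (rule order_trans[OF mnorm_sum_le sum_mono]) (use inc in auto)
  also have "\<dots> = K * c * K * exp \<alpha> * (real N * exp (- \<alpha> * real N))"
    by simp
  also have "\<dots> \<le> K * c * K * exp \<alpha> * (2 / \<alpha> * exp (- (\<alpha> / 2) * real N))"
  proof (rule mult_left_mono)
    \<comment> \<open>\<open>x \<le> exp x\<close> at \<open>x = \<alpha> N / 2\<close> trades the
      factor \<open>N\<close> for half of the exponent.\<close>
    have "\<alpha> / 2 * real N \<le> exp (\<alpha> / 2 * real N)"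
      using exp_ge_add_one_self[of "\<alpha> / 2 * real N"] by linarith
    then have "real N \<le> 2 / \<alpha> * exp (\<alpha> / 2 * real N)"
      using \<alpha> by (simp add: field_simps)
    then have "real N * exp (- \<alpha> * real N) \<le> 2 / \<alpha> * exp (\<alpha> / 2 * real N) * exp (- \<alpha> * real N)"
      by (rule mult_right_mono) simp
    also have "\<dots> = 2 / \<alpha> * exp (- (\<alpha> / 2) * real N)"
      by (simp add: mult_exp_exp)
    finally show "real N * exp (- \<alpha> * real N) \<le> 2 / \<alpha> * exp (- (\<alpha> / 2) * real N)" .
  qed (use K c_nonneg in simp)
  finally show ?thesis by (simp add: m mult.assoc)
qed

text \<open>The limit is the bounded solution of the Sylvester equation that removes the component of the
  coupling \<^term>\<open>Y\<close> from the stable part of \<^term>\<open>\<Psi>\<close> to the unstable part of \<^term>\<open>\<Phi>\<close>.\<close>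

lemma bounded_sylvester_solution:
  obtains H b where "\<And>n. mnorm (H n) \<le> b" "\<And>n. P n ** H n = 0" "\<And>n. H n ** R n = H n"
    "\<And>m n. (mat 1 - P m) ** Y m n ** R n = \<Phi> m n ** H n - H m ** \<Psi> m n"
proof -
  define Q where "Q n = mat 1 - P n" for n
  have Q_inv: "Q m ** \<Phi> m n = \<Phi> m n ** Q n" for m n
    by (simp add: Q_def matrix_distribs P_inv)
  have PQ: "P n ** Q n = 0" for n
    by (simp add: Q_def matrix_distribs P_idem)
  \<comment> \<open>The unstable component at time \<open>q\<close>, transported back to time
    \<open>n\<close>; \<open>H n\<close> will be its limit as \<open>q\<close> tends to
    infinity.\<close>
  define Z where "Z q n = \<Phi> n q ** Q q ** Y q n ** R n" for q n
  \<comment> \<open>The dimension factor pays for changing between \<open>mnorm\<close> and the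
    Euclidean norm.\<close>
  let ?C = "real CARD('k) * real CARD('m)"
  let ?b = "?C * (K * c * K) / (1 - exp (- \<alpha>))"
  have "\<exists>l. (\<lambda>i. Z (n + int i) n) \<longlonglongrightarrow> l \<and> norm l \<le> ?b" for n
  proof -
    have inc: "norm (Z (n + int (Suc i)) n - Z (n + int i) n) \<le> ?C * (K * c * K) * exp (- \<alpha>) ^ i" for i
    proof -
      have "Z (n + int (Suc i)) n - Z (n + int i) n =
          (\<Phi> n (n + int i + 1) ** Q (n + int i + 1)) ** Y (n + int i + 1) (n + int i) ** (\<Psi> (n + int i) n ** R n)"
        using increment[of Q n "n + int i" n] Q_inv by (simp add: Z_def algebra_simps)
      also have "mnorm \<dots> \<le> (K * exp (\<alpha> * real_of_int (n - (n + int i + 1)))) * c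
          * (K * exp (- \<alpha> * real_of_int (n + int i - n)))"
        unfolding Q_def by (intro mnorm_mult_mono Y_step dichotomyD(4)[OF P] dichotomyD(3)[OF R]) auto
      \<comment> \<open>The decay of the \<Psi> factor alone suffices, so that of the \<Phi> factor
        is replaced by 1.\<close>
      also have "\<dots> \<le> (K * 1) * c * (K * exp (- \<alpha> * real_of_int (n + int i - n)))"
        using K c_nonneg \<alpha> by (intro mult_right_mono mult_left_mono) (auto simp: mult_nonneg_nonpos)
      also have "\<dots> = K * c * K * exp (- \<alpha>) ^ i"
        by (simp add: exp_of_nat_mult[symmetric] mult.commute)
      finally have "mnorm (Z (n + int (Suc i)) n - Z (n + int i) n) \<le> K * c * K * exp (- \<alpha>) ^ i" .
      then have "?C * mnorm (Z (n + int (Suc i)) n - Z (n + int i) n) \<le> ?C * (K * c * K * exp (- \<alpha>) ^ i)"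
        by (rule mult_left_mono) simp
      then show ?thesis
        using norm_le_mnorm[of "Z (n + int (Suc i)) n - Z (n + int i) n"] by linarith
    qed
    show ?thesis
      by (rule tendsto_of_geometric_increments[of "\<lambda>i. Z (n + int i) n" "?C * (K * c * K)" "exp (- \<alpha>)", OF _ inc])
        (use \<alpha> in \<open>auto simp: Z_def Y_refl\<close>)
  qed
  then obtain H where H: "\<And>n. (\<lambda>i. Z (n + int i) n) \<longlonglongrightarrow> H n" and b: "\<And>n. norm (H n) \<le> ?b"
    by metis
  have lim: "(\<lambda>i. Z (int i) n) \<longlonglongrightarrow> H n" for n
    using H by (rule LIMSEQ_int_shift)
  show thesis
  proof
    show "mnorm (H n) \<le> ?C * ?b" for n
      by (rule order_trans[OF mnorm_le_norm mult_left_mono[OF b]]) simp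
    show "P n ** H n = 0" for n
    proof (rule LIMSEQ_unique)
      show "(\<lambda>i. P n ** Z (int i) n) \<longlonglongrightarrow> P n ** H n"
        by (intro matrix_mult.tendsto tendsto_const lim)
      have "P n ** Z q n = 0" for q
        by (simp add: Z_def matrix_mul_assoc P_inv PQ[THEN matrix_mul_left_cong])
      then show "(\<lambda>i. P n ** Z (int i) n) \<longlonglongrightarrow> 0" by simp
    qed
    show "H n ** R n = H n" for n
    proof (rule LIMSEQ_unique)
      show "(\<lambda>i. Z (int i) n ** R n) \<longlonglongrightarrow> H n ** R n"
        by (intro matrix_mult.tendsto tendsto_const lim)
      have "Z q n ** R n = Z q n" for q
        by (simp add: Z_def R_idem[THEN matrix_mul_left_cong])
      then show "(\<lambda>i. Z (int i) n ** R n) \<longlonglongrightarrow> H n" by (simp add: lim)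
    qed
    fix m n
    \<comment> \<open>The Sylvester equation holds exactly at each finite \<open>q\<close>, by
      splitting \<open>Y q n\<close> at time \<open>m\<close>; it then passes to the limit.\<close>
    have Z: "\<Phi> m n ** Z q n = Q m ** Y m n ** R n + Z q m ** \<Psi> m n" for q
      unfolding Z_def Y[of q n m]
      by (simp add: matrix_distribs matrix_mul_assoc \<Phi>_simps Q_inv[THEN matrix_mul_left_cong]
          R_inv[THEN matrix_mul_left_cong])
    have "\<Phi> m n ** H n = Q m ** Y m n ** R n + H m ** \<Psi> m n"
    proof (rule LIMSEQ_unique)
      show "(\<lambda>i. \<Phi> m n ** Z (int i) n) \<longlonglongrightarrow> \<Phi> m n ** H n"
        by (intro matrix_mult.tendsto tendsto_const lim)
      show "(\<lambda>i. \<Phi> m n ** Z (int i) n) \<longlonglongrightarrow> Q m ** Y m n ** R n + H m ** \<Psi> m n"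
        unfolding Z by (intro tendsto_add matrix_mult.tendsto tendsto_const lim)
    qed
    then show "(mat 1 - P m) ** Y m n ** R n = \<Phi> m n ** H n - H m ** \<Psi> m n"
      by (simp add: Q_def)
  qed
qed

lemma block_upper_dichotomy:
  obtains L X where "L > 0"
    "dichotomy UNIV (\<lambda>m n. block_upper (\<Phi> m n) (Y m n) (\<Psi> m n)) (\<lambda>n. block_upper (P n) (X n) (R n)) L (\<alpha> / 2)"
proof -
  interpret rev: dichotomous_pair "\<lambda>m n. \<Phi> (- m) (- n)" "\<lambda>m n. \<Psi> (- m) (- n)" "\<lambda>m n. Y (- m) (- n)"
    "\<lambda>n. mat 1 - P (- n)" "\<lambda>n. mat 1 - R (- n)" K \<alpha> c
    by (rule reverse)
  obtain H b where H: "\<And>n. mnorm (H n) \<le> b" "\<And>n. P n ** H n = 0" "\<And>n. H n ** R n = H n"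
    "\<And>m n. (mat 1 - P m) ** Y m n ** R n = \<Phi> m n ** H n - H m ** \<Psi> m n"
    using bounded_sylvester_solution by blast
  \<comment> \<open>For the reversed pair stable and unstable are exchanged, so the same
    construction handles the opposite component.\<close>
  obtain H' b' where H': "\<And>n. mnorm (H' n) \<le> b'" "\<And>n. P n ** H' n = H' n" "\<And>n. H' n ** R n = 0"
    "\<And>m n. P m ** Y m n ** (mat 1 - R n) = \<Phi> m n ** H' n - H' m ** \<Psi> m n"
  proof (rule rev.bounded_sylvester_solution)
    fix H b
    assume a: "\<And>n. mnorm (H n) \<le> b" "\<And>n. (mat 1 - P (- n)) ** H n = 0" "\<And>n. H n ** (mat 1 - R (- n)) = H n"
      "\<And>m n. (mat 1 - (mat 1 - P (- m))) ** Y (- m) (- n) ** (mat 1 - R (- n)) =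
        \<Phi> (- m) (- n) ** H n - H m ** \<Psi> (- m) (- n)"
    show thesis
    proof (rule that[of "\<lambda>n. H (- n)" b])
      fix m n
      show "mnorm (H (- n)) \<le> b" by (rule a)
      show "P n ** H (- n) = H (- n)" using a(2)[of "- n"] by (simp add: matrix_distribs)
      show "H (- n) ** R n = 0" using a(3)[of "- n"] by (simp add: matrix_distribs)
      show "P m ** Y m n ** (mat 1 - R n) = \<Phi> m n ** H (- n) - H (- m) ** \<Psi> m n"
        using a(4)[of "- m" "- n"] by simp
    qed
  qed
  define X where "X n = H' n - H n" for n
  define L0 where "L0 = K * c * K * exp \<alpha> * (2 / \<alpha>)"
  \<comment> \<open>The sum of the bounds for the three blocks, large enough for both time
    directions, in which \<open>b\<close> and \<open>b'\<close> swap roles.\<close>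
  define L where "L = K + (K * b' + b * K + K * b + b' * K + L0) + K"
  have nn: "0 \<le> b" "0 \<le> b'" "0 \<le> L0"
    using order_trans[OF mnorm_nonneg H(1)] order_trans[OF mnorm_nonneg H'(1)] K \<alpha> c_nonneg
    by (auto simp: L0_def)
  have "0 \<le> K * b' + b * K + K * b + b' * K + L0" using nn K by simp
  then have L: "L > 0" using K by (simp add: L_def)
  \<comment> \<open>Subtracting \<open>YR\<close> from \<open>PY\<close> cancels
    \<open>P Y R\<close> and leaves the corner entry of the invariance relation.\<close>
  have YR: "Y m n ** R n - P m ** Y m n ** R n = \<Phi> m n ** H n - H m ** \<Psi> m n" for m n
    using H(4)[of m n] by (simp add: matrix_distribs)
  have PY: "P m ** Y m n - P m ** Y m n ** R n = \<Phi> m n ** H' n - H' m ** \<Psi> m n" for m n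
    using H'(4)[of m n] by (simp add: matrix_distribs)
  \<comment> \<open>By \<open>YR\<close> the term \<open>\<Phi> H\<close> cancels;
    \<open>P H' = H'\<close> and \<open>H R = H\<close> then insert a decaying factor into the other
    two.\<close>
  have stable: "\<Phi> m n ** X n + Y m n ** R n
      = (\<Phi> m n ** P n) ** H' n - H m ** (\<Psi> m n ** R n) + P m ** Y m n ** R n" for m n
  proof -
    have "(\<Phi> m n ** P n) ** H' n = \<Phi> m n ** H' n"
      by (simp add: H'(2)[THEN matrix_mul_left_cong])
    moreover have "H m ** (\<Psi> m n ** R n) = H m ** \<Psi> m n"
      by (simp add: R_inv[symmetric] matrix_mul_assoc H(3))
    ultimately show ?thesis using YR[of m n] by (simp add: X_def matrix_distribs algebra_simps)
  qed
  \<comment> \<open>The mirror image, using \<open>PY\<close>, \<open>P H = 0\<close> and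
    \<open>H' R = 0\<close>; \<open>0 - X n\<close> is the corner of \<open>mat 1\<close> minus the
    projection.\<close>
  have unstable: "\<Phi> m n ** (0 - X n) + Y m n ** (mat 1 - R n)
      = (\<Phi> m n ** (mat 1 - P n)) ** H n - H' m ** (\<Psi> m n ** (mat 1 - R n))
        + (mat 1 - P m) ** Y m n ** (mat 1 - R n)" for m n
  proof -
    have "(\<Phi> m n ** (mat 1 - P n)) ** H n = \<Phi> m n ** H n"
      by (simp add: matrix_distribs H(2)[THEN matrix_mul_left_cong])
    moreover have "H' m ** (\<Psi> m n ** (mat 1 - R n)) = H' m ** \<Psi> m n"
      by (simp add: matrix_distribs R_inv[symmetric] matrix_mul_assoc H'(3))
    ultimately show ?thesis using PY[of m n] by (simp add: X_def matrix_distribs algebra_simps)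
  qed
  \<comment> \<open>Here \<open>e\<close> and \<open>e'\<close> stand for the exponentials at rates
    \<alpha> and \<open>\<alpha> / 2\<close>; the two choices of \<open>b1\<close>,
    \<open>b2\<close> are the two time directions.\<close>
  have bound: "K * e + (K * e * b1 + b2 * (K * e) + L0 * e') + K * e \<le> L * e'"
    if "0 \<le> e" "e \<le> e'" "(b1 = b' \<and> b2 = b) \<or> (b1 = b \<and> b2 = b')" for e e' b1 b2
  proof -
    have "K * e + (K * e * b1 + b2 * (K * e) + L0 * e') + K * e
        = (K + K * b1 + b2 * K + K) * e + L0 * e'" by (simp add: algebra_simps)
    also have "\<dots> \<le> (K + K * b1 + b2 * K + K) * e' + L0 * e'"
      using that K nn by (intro add_right_mono mult_left_mono) auto
    also have "\<dots> = (K + K * b1 + b2 * K + K + L0) * e'" by (simp add: algebra_simps)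
    also have "\<dots> \<le> L * e'"
      using that K nn by (intro mult_right_mono) (auto simp: L_def)
    finally show ?thesis .
  qed
  have "dichotomy UNIV (\<lambda>m n. block_upper (\<Phi> m n) (Y m n) (\<Psi> m n))
      (\<lambda>n. block_upper (P n) (X n) (R n)) L (\<alpha> / 2)"
    unfolding dichotomy_def mat_1_block_upper block_upper_mult block_upper_diff
  proof (intro conjI ballI impI)
    fix m n :: int
    \<comment> \<open>\<open>P X = H'\<close> and \<open>X R = - H\<close>, so the corner entry is
      again \<open>X\<close>.\<close>
    show "block_upper (P n ** P n) (P n ** X n + X n ** R n) (R n ** R n) = block_upper (P n) (X n) (R n)"
      by (simp add: P_idem R_idem X_def matrix_distribs H H')
    show "block_upper (P m ** \<Phi> m n) (P m ** Y m n + X m ** \<Psi> m n) (R m ** \<Psi> m n)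
        = block_upper (\<Phi> m n ** P n) (\<Phi> m n ** X n + Y m n ** R n) (\<Psi> m n ** R n)"
      using YR[of m n] PY[of m n] by (simp add: P_inv R_inv X_def matrix_distribs algebra_simps)
    { assume mn: "n \<le> m"
      let ?e = "exp (- \<alpha> * real_of_int (m - n))" and ?e' = "exp (- (\<alpha> / 2) * real_of_int (m - n))"
      have "mnorm (block_upper (\<Phi> m n ** P n) (\<Phi> m n ** X n + Y m n ** R n) (\<Psi> m n ** R n))
          \<le> K * ?e + (K * ?e * b' + b * (K * ?e) + L0 * ?e') + K * ?e"
        unfolding stable L0_def using mn
        by (intro mnorm_block_upper_le mnorm_add_mono mnorm_diff_mono mnorm_mult_mono H(1) H'(1)
            dichotomyD(3)[OF P] dichotomyD(3)[OF R] stable_part_bound) auto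
      also have "\<dots> \<le> L * ?e'"
        using mn \<alpha> by (intro bound) (auto intro!: mult_right_mono)
      finally show "mnorm (block_upper (\<Phi> m n ** P n) (\<Phi> m n ** X n + Y m n ** R n) (\<Psi> m n ** R n))
          \<le> L * exp (- (\<alpha> / 2) * real_of_int (m - n))" . }
    { assume mn: "m \<le> n"
      let ?e = "exp (\<alpha> * real_of_int (m - n))" and ?e' = "exp (\<alpha> / 2 * real_of_int (m - n))"
      have U: "mnorm ((mat 1 - P m) ** Y m n ** (mat 1 - R n)) \<le> L0 * ?e'"
      proof -
        have e: "- (\<alpha> / 2) * real_of_int (- m - (- n)) = \<alpha> / 2 * real_of_int (m - n)"
          by (simp add: field_simps)
        show ?thesis
          using rev.stable_part_bound[of "- n" "- m", unfolded e] mn by (simp add: L0_def)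
      qed
      have "mnorm (block_upper (\<Phi> m n ** (mat 1 - P n)) (\<Phi> m n ** (0 - X n) + Y m n ** (mat 1 - R n))
            (\<Psi> m n ** (mat 1 - R n)))
          \<le> K * ?e + (K * ?e * b + b' * (K * ?e) + L0 * ?e') + K * ?e"
        unfolding unstable using mn
        by (intro mnorm_block_upper_le mnorm_add_mono mnorm_diff_mono mnorm_mult_mono H(1) H'(1)
            dichotomyD(4)[OF P] dichotomyD(4)[OF R] U) auto
      also have "\<dots> \<le> L * ?e'"
        using mn \<alpha> by (intro bound) (auto intro!: mult_right_mono_neg)
      finally show "mnorm (block_upper (\<Phi> m n ** (mat 1 - P n)) (\<Phi> m n ** (0 - X n) + Y m n ** (mat 1 - R n))
            (\<Psi> m n ** (mat 1 - R n))) \<le> L * exp (\<alpha> / 2 * real_of_int (m - n))" . }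
  qed
  with L show thesis by (rule that)
qed

end

section \<open>The spectra\<close>

lemma lya_seq_scaleR:
  assumes "lya_seq T M" "r \<noteq> 0"
  shows "lya_seq T (\<lambda>n. r *\<^sub>R M n)"
proof -
  have inv: "invertible (r *\<^sub>R M n)" "matrix_inv (r *\<^sub>R M n) = inverse r *\<^sub>R matrix_inv (M n)"
    if "n \<in> T" for n
  proof -
    have M: "invertible (M n)" using assms that by (simp add: lya_seq_def)
    have 1: "(r *\<^sub>R M n) ** (inverse r *\<^sub>R matrix_inv (M n)) = mat 1"
      and 2: "(inverse r *\<^sub>R matrix_inv (M n)) ** (r *\<^sub>R M n) = mat 1"
      using M assms(2) by (simp_all add: matrix_mult.scaleR_left matrix_mult.scaleR_right)
    show "invertible (r *\<^sub>R M n)" using 1 2 unfolding invertible_def by blast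
    show "matrix_inv (r *\<^sub>R M n) = inverse r *\<^sub>R matrix_inv (M n)" using 1 2 by (rule matrix_inv_eqI)
  qed
  have "bounded ((\<lambda>n. r *\<^sub>R M n) ` T)" "bounded ((\<lambda>n. inverse r *\<^sub>R matrix_inv (M n)) ` T)"
    using assms bounded_scaling[of "M ` T" r] bounded_scaling[of "(\<lambda>n. matrix_inv (M n)) ` T" "inverse r"]
    by (simp_all add: lya_seq_def bounded_seq_def image_image)
  then show ?thesis by (simp add: lya_seq_def bounded_seq_def inv cong: image_cong)
qed

lemma bounded_seq_scaleR: "bounded_seq T M \<Longrightarrow> bounded_seq T (\<lambda>n. r *\<^sub>R M n)"
  using bounded_scaling[of "M ` T" r] by (simp add: bounded_seq_def image_image)

lemma block_upper_has_ED_half_lines: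
  assumes A: "\<And>n. invertible (A n)" and B: "\<And>n. invertible (B n)"
    and ED: "has_ED UNIV (\<lambda>n. block_upper (A n) (C n) (B n))"
  shows "has_ED {0..} A" "has_ED {..0} A" "has_ED {0..} B" "has_ED {..0} B"
proof -
  let ?D = "\<lambda>n. block_upper (A n) (C n) (B n)"
  obtain Y where Y: "evol ?D = (\<lambda>m n. block_upper (evol A m n) (Y m n) (evol B m n))"
    using evol_block_upper[of A B C, OF A B] by blast
  obtain K \<alpha> P where K: "K > 0" "\<alpha> > 0" and D: "dichotomy UNIV (evol ?D) P K \<alpha>"
    using ED by (auto simp: has_ED_iff_dichotomy)
  have c: "cocycle (evol ?D)" using A B by (intro cocycle_evol block_upper_matrix_inv)
  obtain L P' R' where "L > 0" "dichotomy {0..} (evol A) P' L \<alpha>" "dichotomy {0..} (evol B) R' L \<alpha>"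
    using block_upper_dichotomy_half_line[OF c[unfolded Y] dichotomy_subset[OF D[unfolded Y] subset_UNIV] K]
    by blast
  with K(2) show "has_ED {0..} A" "has_ED {0..} B" unfolding has_ED_iff_dichotomy by blast+
  \<comment> \<open>The reversed dichotomy is restricted to \<open>{0..}\<close>; a second reversal
    carries the result to \<open>{..0}\<close>.\<close>
  have D': "dichotomy {0..} (\<lambda>m n. block_upper (evol A (- m) (- n)) (Y (- m) (- n)) (evol B (- m) (- n)))
      (\<lambda>n. mat 1 - P (- n)) K \<alpha>"
    using dichotomy_subset[OF dichotomy_uminus[OF D[unfolded Y]]] by simp
  obtain L P' R' where L: "L > 0" and
    AB: "dichotomy {0..} (\<lambda>m n. evol A (- m) (- n)) P' L \<alpha>"
    "dichotomy {0..} (\<lambda>m n. evol B (- m) (- n)) R' L \<alpha>"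
    using block_upper_dichotomy_half_line[OF cocycle_uminus[OF c[unfolded Y]] D' K] by blast
  have "dichotomy {..0} (evol A) (\<lambda>n. mat 1 - P' (- n)) L \<alpha>"
    "dichotomy {..0} (evol B) (\<lambda>n. mat 1 - R' (- n)) L \<alpha>"
    using dichotomy_uminus[OF AB(1)] dichotomy_uminus[OF AB(2)] by simp_all
  with L K(2) show "has_ED {..0} A" "has_ED {..0} B" unfolding has_ED_iff_dichotomy by blast+
qed

text \<open>Bounded inverses of \<open>A\<close> and \<open>B\<close> enter through the backward
  coupling step \<open>- A^-1 C B^-1\<close>.\<close>

lemma has_ED_block_upper:
  assumes A: "lya_seq UNIV A" and B: "lya_seq UNIV B" and C: "bounded_seq UNIV C"
    and ED: "has_ED UNIV A" "has_ED UNIV B"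
  shows "has_ED UNIV (\<lambda>n. block_upper (A n) (C n) (B n))"
proof -
  let ?D = "\<lambda>n. block_upper (A n) (C n) (B n)"
  have iA: "invertible (A n)" and iB: "invertible (B n)" for n
    using A B by (auto simp: lya_seq_def)
  obtain Y where Y: "evol ?D = (\<lambda>m n. block_upper (evol A m n) (Y m n) (evol B m n))"
    "\<And>n. Y (n + 1) n = C n" "\<And>n. Y n (n + 1) = - (matrix_inv (A n) ** C n ** matrix_inv (B n))"
    using evol_block_upper[of A B C, OF iA iB] by blast
  have c: "cocycle (evol ?D)" using iA iB by (intro cocycle_evol block_upper_matrix_inv)
  obtain a where a: "\<And>n. mnorm (matrix_inv (A n)) \<le> a"
    using A bounded_seq_mnorm[of UNIV "\<lambda>n. matrix_inv (A n)"] by (auto simp: lya_seq_def)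
  obtain b where b: "\<And>n. mnorm (matrix_inv (B n)) \<le> b"
    using B bounded_seq_mnorm[of UNIV "\<lambda>n. matrix_inv (B n)"] by (auto simp: lya_seq_def)
  obtain g where g: "\<And>n. mnorm (C n) \<le> g"
    using C bounded_seq_mnorm[of UNIV C] by auto
  obtain K1 \<alpha>1 P where 1: "K1 > 0" "\<alpha>1 > 0" "dichotomy UNIV (evol A) P K1 \<alpha>1"
    using ED(1) by (auto simp: has_ED_iff_dichotomy)
  obtain K2 \<alpha>2 R where 2: "K2 > 0" "\<alpha>2 > 0" "dichotomy UNIV (evol B) R K2 \<alpha>2"
    using ED(2) by (auto simp: has_ED_iff_dichotomy)
  \<comment> \<open>The weaker of the two sets of constants serves both diagonal systems.\<close>
  define K \<alpha> where "K = max K1 K2" and "\<alpha> = min \<alpha>1 \<alpha>2"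
  \<comment> \<open>\<open>g\<close> bounds the forward steps of \<open>Y\<close>, and
    \<open>a * g * b\<close> the backward ones.\<close>
  have "dichotomous_pair (evol A) (evol B) Y P R K \<alpha> (max g (a * g * b))"
  proof
    show "Y m l = evol A m n ** Y n l + Y m n ** evol B n l" for m n l
      using c unfolding Y(1) by (auto simp: cocycle_def)
    show "dichotomy UNIV (evol A) P K \<alpha>" "dichotomy UNIV (evol B) R K \<alpha>"
      using 1 2 by (auto intro: dichotomy_mono simp: K_def \<alpha>_def)
    show "mnorm (Y (n + 1) n) \<le> max g (a * g * b)" for n
      using g by (simp add: Y(2) le_max_iff_disj)
    show "mnorm (Y n (n + 1)) \<le> max g (a * g * b)" for n
      using mnorm_mult_mono[OF mnorm_mult_mono[OF a g] b] by (simp add: Y(3) le_max_iff_disj)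
  qed (use 1 2 iA iB in \<open>auto simp: K_def \<alpha>_def cocycle_evol\<close>)
  then obtain L X where "L > 0" "dichotomy UNIV (evol ?D) (\<lambda>n. block_upper (P n) (X n) (R n)) L (\<alpha> / 2)"
    unfolding Y(1) by (rule dichotomous_pair.block_upper_dichotomy)
  moreover have "\<alpha> / 2 > 0" using 1 2 by (simp add: \<alpha>_def)
  ultimately show ?thesis unfolding has_ED_iff_dichotomy by blast
qed

theorem theorem3p2:
  fixes A :: "int \<Rightarrow> real^'k::finite^'k"
    and B :: "int \<Rightarrow> real^'m::finite^'m"
    and C :: "int \<Rightarrow> real^'m^'k"
  assumes "lya_seq UNIV A" and "lya_seq UNIV B" and "bounded_seq UNIV C"
  shows "(Sigma_ED_plus A \<union> Sigma_ED_minus A) \<union> (Sigma_ED_plus B \<union> Sigma_ED_minus B)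
           \<subseteq> Sigma_ED (\<lambda>n. block_upper (A n) (C n) (B n))
       \<and> Sigma_ED (\<lambda>n. block_upper (A n) (C n) (B n)) \<subseteq> Sigma_ED A \<union> Sigma_ED B"
proof -
  \<comment> \<open>Both inclusions are shown by contraposition at a fixed \<gamma>: the factor
    \<open>exp (- \<gamma>)\<close> scales all blocks alike and preserves the hypotheses.\<close>
  have "has_ED {0..} (\<lambda>n. exp (- \<gamma>) *\<^sub>R A n) \<and> has_ED {..0} (\<lambda>n. exp (- \<gamma>) *\<^sub>R A n) \<and>
      has_ED {0..} (\<lambda>n. exp (- \<gamma>) *\<^sub>R B n) \<and> has_ED {..0} (\<lambda>n. exp (- \<gamma>) *\<^sub>R B n)"
    if "has_ED UNIV (\<lambda>n. exp (- \<gamma>) *\<^sub>R block_upper (A n) (C n) (B n))" for \<gamma>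
    using lya_seq_scaleR[OF assms(1), of "exp (- \<gamma>)"] lya_seq_scaleR[OF assms(2), of "exp (- \<gamma>)"]
      block_upper_has_ED_half_lines[OF _ _ that[unfolded block_upper_scaleR]]
    by (auto simp: lya_seq_def)
  moreover have "has_ED UNIV (\<lambda>n. exp (- \<gamma>) *\<^sub>R block_upper (A n) (C n) (B n))"
    if "has_ED UNIV (\<lambda>n. exp (- \<gamma>) *\<^sub>R A n)" "has_ED UNIV (\<lambda>n. exp (- \<gamma>) *\<^sub>R B n)" for \<gamma>
    unfolding block_upper_scaleR
    by (intro has_ED_block_upper lya_seq_scaleR bounded_seq_scaleR assms that) auto
  ultimately show ?thesis unfolding ED_spectrum_def by blast
qed

end
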